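(* Let $E^1,E^2\subset\mathbb{R}^2$ be two distinct lines through the origin with irrational slopes. Then any quasi-Markov partition of $\mathbb{T}^2$ for the directions $E^1,E^2$ consisting of two elements can be obtained from a suitable T-configuration $(P,L,I)$: that is, for some T-configuration the complement $\mathbb{T}^2\setminus(P_1^\circ\cup P_2^\circ)$ of the interiors of the two parallelograms of the partition equals $PC\cup I$.
   Context: $\mathbb{T}^2=\mathbb{R}^2/\mathbb{Z}^2$, $p:\mathbb{R}^2\to\mathbb{T}^2$ is the projection. Fix two distinct lines $E^1,E^2$ through the origin of $\mathbb{R}^2$ with irrational slopes. A Markov parallelogram in the plane (for the directions $E^1,E^2$) is a closed parallelogram $\Pi$ with two sides parallel to $E^1$ and two sides parallel to $E^2$. A Markov parallelogram in the torus is $P=p(\Pi)$ for such a $\Pi$ provided $p$ is injective on $\mathrm{int}\,\Pi$; one writes $P^\circ=p(\mathrm{int}\,\Pi)$. A quasi-Markov partition (qMp) is a finite system $\{P_1,\ldots,P_k\}$ of Markov parallelograms in the torus such that the $P_i^\circ$ are pairwise disjoint and $\mathbb{T}^2\setminus(P_1^\circ\cup\ldots\cup P_k^\circ)$ is a finite union of arcs lying on projections of lines parallel to $E^1$ or $E^2$. A T-configuration consists of the following data. A point $P=p(Q)\in\mathbb{T}^2$; a choice of one of the lines $E^1+Q,E^2+Q$, say $E^1+Q$ (the other choice is also allowed and is treated in the same way with the roles of $E^1,E^2$ exchanged); a ray $L$ of the other line $E^2+Q$ beginning at $Q$; and an arc $I$ of $p(E^1+Q)$ passing through $P$ (with $P$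 in its interior) with endpoints $A,B$ such that, denoting by $z(t)$, $t\ge 0$, the point of $L$ at distance $t$ from $Q$, one has $A=p(z(t_A))$, $B=p(z(t_B))$ with $0<t_A<t_B$ and $p(z(t))\notin I$ for $0<t<t_B$, $t\ne t_A$. The point $C$ is $p(z(t_C))$, where $t_C>t_B$ is the smallest $t>t_B$ with $p(z(t))\in I$, and the arc $PC$ is $\{p(z(t)):0\le t\le t_C\}$. The partition obtained from the T-configuration is the one whose parallelograms have as interiors the connected components of $\mathbb{T}^2\setminus(PC\cup I)$. *)

theory Defs
  imports "HOL-Analysis.Analysis"
begin

definition lattice_rel :: "real \<times> real \<Rightarrow> real \<times> real \<Rightarrow> bool" where
  "lattice_rel x y \<longleftrightarrow> fst x - fst y \<in> \<int> \<and> snd x - snd y \<in> \<int>"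

lemma equivp_lattice_rel: "equivp lattice_rel"
proof (rule equivpI)
  show "reflp lattice_rel"
    by (simp add: reflp_def lattice_rel_def)
  show "symp lattice_rel"
    unfolding symp_def lattice_rel_def by (metis Ints_minus minus_diff_eq)
  show "transp lattice_rel"
  proof (rule transpI)
    fix x y z assume "lattice_rel x y" "lattice_rel y z"
    then have "(fst x - fst y) + (fst y - fst z) \<in> \<int>" "(snd x - snd y) + (snd y - snd z) \<in> \<int>"
      by (simp_all only: lattice_rel_def Ints_add)
    then show "lattice_rel x z"
      by (simp add: lattice_rel_def)
  qed
qed

text \<open>The torus \<open>\<real>\<^sup>2/\<int>\<^sup>2\<close>; the abstraction function \<open>torus_proj\<close> is the projection.\<close>

quotient_type torus = "real \<times> real" / lattice_rel
  morphisms torus_rep torus_proj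
  by (rule equivp_lattice_rel)

definition irrational_line :: "(real \<times> real) set \<Rightarrow> bool" where
  "irrational_line E \<longleftrightarrow> (\<exists>m. m \<notin> \<rat> \<and> E = {(x, m * x) | x. True})"

definition markov_parallelogram ::
    "(real \<times> real) set \<Rightarrow> (real \<times> real) set \<Rightarrow> (real \<times> real) set \<Rightarrow> bool" where
  "markov_parallelogram E1 E2 R \<longleftrightarrow>
     (\<exists>a u v. u \<in> E1 \<and> u \<noteq> 0 \<and> v \<in> E2 \<and> v \<noteq> 0 \<and>
        R = {a + s *\<^sub>R u + t *\<^sub>R v | s t. s \<in> {0..1} \<and> t \<in> {0..1}})"

text \<open>
  A Markov parallelogram in the torus is represented by a planar parallelogram \<open>R\<close>,
  standing for the set \<open>P = torus_proj ` R\<close> together with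
  \<open>P\<^sup>\<circ> = torus_proj ` interior R\<close>. The plane set is kept because
  \<open>P\<close> alone does not determine \<open>P\<^sup>\<circ>\<close>: the opposite sides of \<open>R\<close> may be
  partly glued in the torus, and then \<open>P\<close> can be the image of differently cut parallelograms.
\<close>

definition torus_markov_parallelogram ::
    "(real \<times> real) set \<Rightarrow> (real \<times> real) set \<Rightarrow> (real \<times> real) set \<Rightarrow> bool" where
  "torus_markov_parallelogram E1 E2 R \<longleftrightarrow>
     markov_parallelogram E1 E2 R \<and> inj_on torus_proj (interior R)"

definition torus_arc :: "(real \<times> real) set \<Rightarrow> torus set \<Rightarrow> bool" where
  "torus_arc E \<alpha> \<longleftrightarrow>
     (\<exists>a b. a \<noteq> b \<and> b - a \<in> E \<and> \<alpha> = torus_proj ` closed_segment a b)"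

definition interiors_complement :: "(real \<times> real) set set \<Rightarrow> torus set" where
  "interiors_complement M = UNIV - (\<Union>R\<in>M. torus_proj ` interior R)"

text \<open>
  Distinct members of \<open>M\<close> have nonempty disjoint interiors in the torus, hence distinct
  images; so \<open>card M\<close> is the number of elements of the partition.
\<close>

definition quasi_markov_partition ::
    "(real \<times> real) set \<Rightarrow> (real \<times> real) set \<Rightarrow> (real \<times> real) set set \<Rightarrow> bool" where
  "quasi_markov_partition E1 E2 M \<longleftrightarrow>
     finite M \<and>
     (\<forall>R\<in>M. torus_markov_parallelogram E1 E2 R) \<and>
     pairwise (\<lambda>R R'. disjnt (torus_proj ` interior R) (torus_proj ` interior R')) M \<and>
     (\<exists>\<A>. finite \<A> \<and> (\<forall>\<alpha>\<in>\<A>. torus_arc E1 \<alpha> \<or> torus_arc E2 \<alpha>) \<and>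
          interiors_complement M = \<Union>\<A>)"

definition ray_point :: "real \<times> real \<Rightarrow> real \<times> real \<Rightarrow> real \<Rightarrow> real \<times> real" where
  "ray_point Q w t = Q + t *\<^sub>R w"

text \<open>
  \<open>I\<close> is an arc of the projection of \<open>E + Q\<close>, and \<open>L\<close> is the ray
  \<open>{Q + t w | t \<ge> 0}\<close> of \<open>F + Q\<close>; since \<open>w\<close> is a unit vector, \<open>t\<close> is the
  distance from \<open>Q\<close>. The points \<open>a\<close>, \<open>b\<close> of \<open>E + Q\<close> lift the endpoints
  \<open>A\<close>, \<open>B\<close> of \<open>I\<close>; either may lie on either side of \<open>Q\<close>.
\<close>

definition T_configuration_on ::
    "(real \<times> real) set \<Rightarrow> (real \<times> real) set \<Rightarrow> real \<times> real \<Rightarrow> real \<times> real \<Rightarrow> torus set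
      \<Rightarrow> real \<Rightarrow> real \<Rightarrow> bool" where
  "T_configuration_on E F Q w I tA tB \<longleftrightarrow>
     w \<in> F \<and> norm w = 1 \<and>
     0 < tA \<and> tA < tB \<and>
     (\<exists>a b. a - Q \<in> E \<and> b - Q \<in> E \<and> Q \<in> open_segment a b \<and>
        I = torus_proj ` closed_segment a b \<and>
        torus_proj a = torus_proj (ray_point Q w tA) \<and>
        torus_proj b = torus_proj (ray_point Q w tB)) \<and>
     (\<forall>t. 0 < t \<and> t < tB \<and> t \<noteq> tA \<longrightarrow> torus_proj (ray_point Q w t) \<notin> I)"

definition T_configuration ::
    "(real \<times> real) set \<Rightarrow> (real \<times> real) set \<Rightarrow> real \<times> real \<Rightarrow> real \<times> real \<Rightarrow> torus set
      \<Rightarrow> real \<Rightarrow> real \<Rightarrow> bool" where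
  "T_configuration E1 E2 Q w I tA tB \<longleftrightarrow>
     T_configuration_on E1 E2 Q w I tA tB \<or> T_configuration_on E2 E1 Q w I tA tB"

definition next_hit :: "real \<times> real \<Rightarrow> real \<times> real \<Rightarrow> torus set \<Rightarrow> real \<Rightarrow> real \<Rightarrow> bool" where
  "next_hit Q w I tB tC \<longleftrightarrow>
     tB < tC \<and> torus_proj (ray_point Q w tC) \<in> I \<and>
     (\<forall>t. tB < t \<and> t < tC \<longrightarrow> torus_proj (ray_point Q w t) \<notin> I)"

definition arc_PC :: "real \<times> real \<Rightarrow> real \<times> real \<Rightarrow> real \<Rightarrow> torus set" where
  "arc_PC Q w tC = (\<lambda>t. torus_proj (ray_point Q w t)) ` {0..tC}"

end

(*
  In coordinates with axes along the two directions, the partition becomes a tiling of the plane by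
  the translates of two boxes under a lattice without axis-parallel vectors. Modulo the lattice,
  the bottom left corner of each box is the top left or the bottom right corner of the other box,
  since two corners of the same box cannot match. If both boxes fell into the same one of these
  cases, adding the two matching vectors would give an axis-parallel lattice vector; so each case
  occurs once. The same dichotomy for bottom right corners gives a third matching vector. Hence the
  boxes stand side by side on a common base, their outer sides being glued to the vertical through
  the common bottom corner: I is the base and PC is this vertical, of length the sum of the heights.
*)

theory Submission
  imports Defs
begin

section \<open>Tilings of the plane by lattice translates of two boxes\<close>

text \<open>
  \<open>overlap\<close> says that distinct translates of tiles have disjoint interiors, and \<open>quadrant\<close> that
  at the corner \<open>(p, q)\<close> of any quadrant a single closed translate fills the quadrant locally.
\<close>

locale box_tiling =
  fixes \<Lambda> :: "(real \<times> real) set" and l r b t :: "bool \<Rightarrow> real"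
  assumes add: "(x, y) \<in> \<Lambda> \<Longrightarrow> (x', y') \<in> \<Lambda> \<Longrightarrow> (x + x', y + y') \<in> \<Lambda>"
    and neg: "(x, y) \<in> \<Lambda> \<Longrightarrow> (- x, - y) \<in> \<Lambda>"
    and horizontal: "(x, 0) \<in> \<Lambda> \<Longrightarrow> x = 0"
    and vertical: "(0, y) \<in> \<Lambda> \<Longrightarrow> y = 0"
    and width_pos: "l i < r i" and height_pos: "b i < t i"
    and overlap: "(x, y) \<in> \<Lambda> \<Longrightarrow> l i < r j + x \<Longrightarrow> l j + x < r i \<Longrightarrow> b i < t j + y \<Longrightarrow> b j + y < t i
      \<Longrightarrow> i = j \<and> x = 0 \<and> y = 0"
    and quadrant: "\<sigma> \<in> {-1, 1} \<Longrightarrow> \<tau> \<in> {-1, 1} \<Longrightarrow> \<exists>j x y d. (x, y) \<in> \<Lambda> \<and> 0 < d \<and>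
      l j + x \<le> p \<and> p \<le> r j + x \<and> l j + x \<le> p + \<sigma> * d \<and> p + \<sigma> * d \<le> r j + x \<and>
      b j + y \<le> q \<and> q \<le> t j + y \<and> b j + y \<le> q + \<tau> * d \<and> q + \<tau> * d \<le> t j + y"
begin

lemma diff: "(x, y) \<in> \<Lambda> \<Longrightarrow> (x', y') \<in> \<Lambda> \<Longrightarrow> (x - x', y - y') \<in> \<Lambda>"
  using add[OF _ neg] by fastforce

lemma overlap_translates:
  assumes "(x, y) \<in> \<Lambda>" "(x', y') \<in> \<Lambda>"
    and "l i + x < r j + x'" "l j + x' < r i + x" "b i + y < t j + y'" "b j + y' < t i + y"
  shows "i = j \<and> x = x' \<and> y = y'"
  using overlap[OF diff[OF assms(2,1)], of i j] assms(3-) by auto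

text \<open>The assumptions name no element of \<open>\<Lambda>\<close>; a filled quadrant supplies
  one, and its difference with itself is zero.\<close>

lemma zero: "(0, 0) \<in> \<Lambda>"
proof -
  obtain x y where "(x, y) \<in> \<Lambda>" using quadrant[of 1 1] by blast
  from diff[OF this this] show ?thesis by simp
qed

text \<open>
  The tile filling the lower right quadrant at the bottom left corner of tile \<open>i\<close> has its top on
  the bottom line of tile \<open>i\<close>. Unless its corner is there, it extends to the left
  below the corner, and the tile in the upper left quadrant must have its own corner there.
\<close>

lemma bottom_left_corner:
  "(l i - l (\<not> i), b i - t (\<not> i)) \<in> \<Lambda> \<or> (l i - r (\<not> i), b i - b (\<not> i)) \<in> \<Lambda>"
proof -
  obtain j x y d where j: "(x, y) \<in> \<Lambda>" "0 < d" "l j + x \<le> l i" "l i + d \<le> r j + x"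
      "b j + y \<le> b i - d" "b i \<le> t j + y"
    using quadrant[of 1 "-1" "l i" "b i"] by auto
  \<comment> \<open>A top above \<open>b i\<close> would make tile \<open>j\<close> overlap tile
    \<open>i\<close> near the corner, so it would be tile \<open>i\<close> itself, which does not
    reach below its own bottom.\<close>
  have top: "b i = t j + y"
  proof (rule ccontr)
    assume "b i \<noteq> t j + y"
    then have "i = j \<and> x = 0 \<and> y = 0"
      using j width_pos[of i] height_pos[of i] by (intro overlap) auto
    then show False using j by auto
  qed
  show ?thesis
  proof (cases "l i = l j + x")
    case True
    have "(l i - l j, b i - t j) \<in> \<Lambda>" using j(1) top True by simp
    moreover have "j \<noteq> i"
    proof
      assume "j = i"
      then show False using vertical[of y] j(1) True top height_pos[of i] by simp
    qed
    then have "j = (\<not> i)" by auto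
    ultimately show ?thesis by simp
  next
    case False
    obtain k x' y' d' where k: "(x', y') \<in> \<Lambda>" "0 < d'" "l k + x' \<le> l i - d'" "l i \<le> r k + x'"
        "b k + y' \<le> b i" "b i + d' \<le> t k + y'"
      using quadrant[of "-1" 1 "l i" "b i"] by auto
    have right: "l i = r k + x'"
    proof (rule ccontr)
      assume "l i \<noteq> r k + x'"
      then have "i = k \<and> x' = 0 \<and> y' = 0"
        using k width_pos[of i] height_pos[of i] by (intro overlap) auto
      then show False using k by auto
    qed
    \<comment> \<open>Otherwise both tiles contain points just left of the corner and just below
      \<open>b i\<close>, hence coincide; but tile \<open>k\<close> rises above \<open>b i\<close>,
      where tile \<open>j\<close> ends.\<close>
    have bottom: "b i = b k + y'"
    proof (rule ccontr)
      assume "b i \<noteq> b k + y'"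
      then have "j = k \<and> x = x' \<and> y = y'"
        using j k False top right by (intro overlap_translates) auto
      then show False using k top by auto
    qed
    have "(l i - r k, b i - b k) \<in> \<Lambda>" using k(1) right bottom by simp
    moreover have "k \<noteq> i"
    proof
      assume "k = i"
      then show False using horizontal[of x'] k(1) right bottom width_pos[of i] by simp
    qed
    then have "k = (\<not> i)" by auto
    ultimately show ?thesis by simp
  qed
qed

text \<open>The mirror image in a vertical axis exchanges left and right sides, so that results on
  bottom left corners transfer to bottom right corners.\<close>

lemma reflected: "box_tiling {(x, y). (- x, y) \<in> \<Lambda>} (\<lambda>i. - r i) (\<lambda>i. - l i) b t"
proof
  fix \<sigma> \<tau> p q :: real assume \<sigma>: "\<sigma> \<in> {-1, 1}" and \<tau>: "\<tau> \<in> {-1, 1}"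
  from \<sigma> have "- \<sigma> \<in> {-1, 1}" by auto
  from quadrant[OF this \<tau>, of "- p" q] obtain j x y d where
    *: "(x, y) \<in> \<Lambda>" "0 < d" "l j + x \<le> - p" "- p \<le> r j + x"
      "l j + x \<le> - p + - \<sigma> * d" "- p + - \<sigma> * d \<le> r j + x"
      "b j + y \<le> q" "q \<le> t j + y" "b j + y \<le> q + \<tau> * d" "q + \<tau> * d \<le> t j + y" by blast
  show "\<exists>j x y d. (x, y) \<in> {(x, y). (- x, y) \<in> \<Lambda>} \<and> 0 < d \<and>
      - r j + x \<le> p \<and> p \<le> - l j + x \<and> - r j + x \<le> p + \<sigma> * d \<and> p + \<sigma> * d \<le> - l j + x \<and>
      b j + y \<le> q \<and> q \<le> t j + y \<and> b j + y \<le> q + \<tau> * d \<and> q + \<tau> * d \<le> t j + y"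
    using * by (intro exI[of _ j] exI[of _ "- x"] exI[of _ y] exI[of _ d]) auto
next
  fix x y i j
  assume "(x, y) \<in> {(x, y). (- x, y) \<in> \<Lambda>}" "- r i < - l j + x" "- r j + x < - l i"
    "b i < t j + y" "b j + y < t i"
  then show "i = j \<and> x = 0 \<and> y = 0"
    using overlap[of "- x" y i j] by auto
next
  fix x y x' y'
  assume "(x, y) \<in> {(x, y). (- x, y) \<in> \<Lambda>}" "(x', y') \<in> {(x, y). (- x, y) \<in> \<Lambda>}"
  then show "(x + x', y + y') \<in> {(x, y). (- x, y) \<in> \<Lambda>}"
    using add[of "- x" y "- x'" y'] by auto
qed (use neg horizontal vertical width_pos height_pos in fastforce)+

lemma bottom_right_corner:
  "(r i - r (\<not> i), b i - t (\<not> i)) \<in> \<Lambda> \<or> (r i - l (\<not> i), b i - b (\<not> i)) \<in> \<Lambda>"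
  using box_tiling.bottom_left_corner[OF reflected, of i] by simp

text \<open>
  If the bottom left corners of both tiles matched top left corners, or both matched bottom right
  corners, the sum of the two matching vectors would be an axis-parallel lattice vector.
\<close>

lemma corner_matching:
  obtains i where "(l i - r (\<not> i), b i - b (\<not> i)) \<in> \<Lambda>"
    and "(r (\<not> i) - l (\<not> i), t i - b i) \<in> \<Lambda>"
    and "(- (r i - l i), t (\<not> i) - b (\<not> i)) \<in> \<Lambda>"
proof -
  let ?L = "\<lambda>i. (l i - l (\<not> i), b i - t (\<not> i)) \<in> \<Lambda>"
  let ?B = "\<lambda>i. (l i - r (\<not> i), b i - b (\<not> i)) \<in> \<Lambda>"
  have L: "\<not> (?L True \<and> ?L False)"
    using vertical[of "b True - t False + (b False - t True)"] height_pos[of True] height_pos[of False]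
      add[of "l True - l False" "b True - t False" "l False - l True" "b False - t True"]
    by auto
  have B: "\<not> (?B i \<and> ?B (\<not> i))" for i
    using horizontal[of "l i - r (\<not> i) + (l (\<not> i) - r i)"] width_pos[of True] width_pos[of False]
      add[of "l i - r (\<not> i)" "b i - b (\<not> i)" "l (\<not> i) - r i" "b (\<not> i) - b i"]
    by (cases i) auto
  obtain i where "\<not> ?L i" using L by blast
  then have 1: "?B i" using bottom_left_corner by blast
  then have 2: "?L (\<not> i)" using B[of i] bottom_left_corner[of "\<not> i"] by blast
  \<comment> \<open>Up to sign this vector is that of \<open>?B (\<not> i)\<close>, which
    \<open>1\<close> excludes.\<close>
  have "(r i - l (\<not> i), b i - b (\<not> i)) \<notin> \<Lambda>"
    using B[of i] 1 neg[of "r i - l (\<not> i)" "b i - b (\<not> i)"] by auto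
  then have 3: "(r i - r (\<not> i), b i - t (\<not> i)) \<in> \<Lambda>" using bottom_right_corner by blast
  show thesis
    \<comment> \<open>The two remaining vectors are \<open>- (2 + 1)\<close> and
      \<open>1 - 3\<close>.\<close>
    by (rule that[OF 1]) (use neg[OF add[OF 2 1]] diff[OF 1 3] in auto)
qed

text \<open>For a partition these are the coordinates of the points of
  \<open>interiors_complement M\<close>.\<close>

definition free :: "real \<Rightarrow> real \<Rightarrow> bool" where
  "free p q \<longleftrightarrow> (\<forall>j x y. (x, y) \<in> \<Lambda> \<longrightarrow>
     \<not> (l j + x < p \<and> p < r j + x \<and> b j + y < q \<and> q < t j + y))"

text \<open>An open tile containing a point of a closed tile overlaps it, hence is the same
  translate; but a point on a side is not interior to that translate.\<close>

lemma free_boundary: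
  assumes g: "(x, y) \<in> \<Lambda>" and p: "l j + x \<le> p" "p \<le> r j + x" and q: "b j + y \<le> q" "q \<le> t j + y"
    and side: "p = l j + x \<or> p = r j + x \<or> q = b j + y \<or> q = t j + y"
  shows "free p q"
  unfolding free_def
proof (intro allI impI notI)
  fix k x' y' assume g': "(x', y') \<in> \<Lambda>" and k: "l k + x' < p \<and> p < r k + x' \<and> b k + y' < q \<and> q < t k + y'"
  then have "j = k \<and> x = x' \<and> y = y'"
    using g p q by (intro overlap_translates) auto
  then show False using side k by auto
qed

lemma free_imp_boundary:
  assumes "free p q"
  obtains j x y where "(x, y) \<in> \<Lambda>" "l j + x \<le> p" "p \<le> r j + x" "b j + y \<le> q" "q \<le> t j + y"
    "p = l j + x \<or> p = r j + x \<or> q = b j + y \<or> q = t j + y"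
proof -
  obtain j x y where *: "(x, y) \<in> \<Lambda>" "l j + x \<le> p" "p \<le> r j + x" "b j + y \<le> q" "q \<le> t j + y"
    using quadrant[of 1 1 p q] by auto
  then show thesis
    using assms[unfolded free_def, rule_format, OF *(1), of j] by (intro that[OF *]) auto
qed

end

text \<open>
  The tile \<open>i\<close> and a translate of the other tile stand side by side on a common horizontal
  base, their bottom corners meeting at \<open>(l i, b i)\<close>. The vectors \<open>(w, h)\<close>
  and \<open>(- w', h')\<close> are the lattice vectors gluing their outer sides to the vertical through that corner.
\<close>

locale matched_box_tiling = box_tiling +
  fixes i :: bool and w w' h h' :: real
  defines "w \<equiv> r (\<not> i) - l (\<not> i)" and "h' \<equiv> t (\<not> i) - b (\<not> i)"
    and "w' \<equiv> r i - l i" and "h \<equiv> t i - b i"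
  assumes base: "(l i - r (\<not> i), b i - b (\<not> i)) \<in> \<Lambda>"
    and glue_left: "(w, h) \<in> \<Lambda>" and glue_right: "(- w', h') \<in> \<Lambda>"
begin

lemma dims_pos: "0 < w" "0 < w'" "0 < h" "0 < h'"
  using width_pos height_pos by (auto simp: w_def w'_def h_def h'_def)

text \<open>Otherwise \<open>glue_left\<close> minus \<open>glue_right\<close> would be the
  horizontal lattice vector \<open>(w + w', 0)\<close>. This makes \<open>tA < tB\<close>
  strict.\<close>

lemma heights_differ: "h \<noteq> h'"
  using horizontal[of "w + w'"] diff[OF glue_left glue_right] dims_pos by auto

text \<open>Membership would make the point at height \<open>s\<close> on the vertical a copy of the
  base point at offset \<open>x\<close> from the common corner. The ends and the corner of the base
  allow only the heights \<open>h'\<close>, \<open>h\<close> and 0; at any other base point a tile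
  would straddle the vertical.\<close>

lemma vertical_avoids_base:
  assumes s: "0 < s" "s < h + h'" "s \<noteq> h" "s \<noteq> h'" and x: "- w \<le> x" "x \<le> w'"
  shows "(- x, s) \<notin> \<Lambda>"
proof
  assume g: "(- x, s) \<in> \<Lambda>"
  consider "x = 0" | "x = w'" | "x = - w" | "0 < x" "x < w'" | "- w < x" "x < 0"
    using x by linarith
  then show False
  proof cases
    case 1
    then show ?thesis using vertical[of s] g s by simp
  next
    case 2
    then show ?thesis using vertical[of "s - h'"] diff[OF g glue_right] s by simp
  next
    case 3
    then show ?thesis using vertical[of "s - h"] diff[OF g glue_left] s by simp
  next
    case 4
    \<comment> \<open>Tile \<open>i\<close> moved by \<open>(- x, s)\<close> straddles the vertical.
      Right of the vertical stand tile \<open>i\<close> up to height \<open>h\<close> and then, up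
      to \<open>h + h'\<close>, the copy of the other tile moved by
      \<open>glue_left\<close>.\<close>
    show ?thesis
    proof (cases "s < h")
      case True
      have "i = i \<and> 0 = - x \<and> 0 = s"
        by (rule overlap_translates[OF zero g])
          (use 4 True s dims_pos in \<open>auto simp: w_def w'_def h_def h'_def\<close>)
      then show ?thesis using s by simp
    next
      case False
      have "(\<not> i) = i \<and> l i - r (\<not> i) + w = - x \<and> b i - b (\<not> i) + h = s"
        by (rule overlap_translates[OF add[OF base glue_left] g])
          (use 4 False s dims_pos in \<open>auto simp: w_def w'_def h_def h'_def\<close>)
      then show ?thesis by simp
    qed
  next
    case 5
    \<comment> \<open>Now the other tile straddles the vertical. Left of it stand the other tile up
      to height \<open>h'\<close> and then the copy of tile \<open>i\<close> moved by
      \<open>glue_right\<close>.\<close>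
    show ?thesis
    proof (cases "s < h'")
      case True
      have "(\<not> i) = (\<not> i) \<and> l i - r (\<not> i) = l i - r (\<not> i) + - x \<and> b i - b (\<not> i) = b i - b (\<not> i) + s"
        by (rule overlap_translates[OF base add[OF base g]])
          (use 5 True s dims_pos in \<open>auto simp: w_def w'_def h_def h'_def\<close>)
      then show ?thesis using s by simp
    next
      case False
      have "i = (\<not> i) \<and> - w' = l i - r (\<not> i) + - x \<and> h' = b i - b (\<not> i) + s"
        by (rule overlap_translates[OF glue_right add[OF base g]])
          (use 5 False s dims_pos in \<open>auto simp: w_def w'_def h_def h'_def\<close>)
      then show ?thesis by simp
    qed
  qed
qed

text \<open>Coordinates are relative to the common corner \<open>(l i, b i)\<close>; the bar becomes
  \<open>I\<close>, the stem \<open>PC\<close>.\<close>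

definition on_T :: "real \<Rightarrow> real \<Rightarrow> bool" where
  "on_T p q \<longleftrightarrow> q = 0 \<and> - w \<le> p \<and> p \<le> w' \<or> p = 0 \<and> 0 \<le> q \<and> q \<le> h + h'"

text \<open>The T splits into four tile sides: the two bottoms, the left side of tile
  \<open>i\<close>, and above it the left side of the other tile moved by
  \<open>glue_left\<close>.\<close>

lemma on_T_imp_free:
  assumes "on_T p q"
  shows "free (l i + p) (b i + q)"
proof -
  consider "q = 0" "- w \<le> p" "p \<le> 0" | "q = 0" "0 \<le> p" "p \<le> w'"
    | "p = 0" "0 \<le> q" "q \<le> h" | "p = 0" "h \<le> q" "q \<le> h + h'"
    using assms unfolding on_T_def by linarith
  then show ?thesis
  proof cases
    case 1
    then show ?thesis
      using dims_pos by (intro free_boundary[OF base]) (auto simp: w_def h'_def)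
  next
    case 2
    then show ?thesis
      using dims_pos by (intro free_boundary[OF zero]) (auto simp: w'_def h_def)
  next
    case 3
    then show ?thesis
      using dims_pos by (intro free_boundary[OF zero]) (auto simp: w'_def h_def)
  next
    case 4
    then show ?thesis
      using dims_pos by (intro free_boundary[OF add[OF base glue_left]]) (auto simp: w_def h_def h'_def)
  qed
qed

lemma free_translate:
  assumes "free p q" "(x, y) \<in> \<Lambda>"
  shows "free (p + x) (q + y)"
  unfolding free_def
proof (intro allI impI notI)
  fix j x' y'
  assume g': "(x', y') \<in> \<Lambda>"
    and *: "l j + x' < p + x \<and> p + x < r j + x' \<and> b j + y' < q + y \<and> q + y < t j + y'"
  then show False
    using assms(1)[unfolded free_def, rule_format, OF diff[OF g' assms(2)], of j] by auto
qed

text \<open>For tile \<open>i\<close>, the left side and the bottom are in place,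
  \<open>glue_right\<close> takes the right side to the upper stem, and minus
  \<open>glue_left\<close> takes the top to the bar. The other tile is put in place by
  \<open>base\<close>; then \<open>glue_left\<close> serves its left side and minus
  \<open>glue_right\<close> its top.\<close>

lemma tile_boundary_on_T:
  assumes "l j \<le> p" "p \<le> r j" "b j \<le> q" "q \<le> t j" "p = l j \<or> p = r j \<or> q = b j \<or> q = t j"
  shows "\<exists>x y. (x, y) \<in> \<Lambda> \<and> on_T (p - l i + x) (q - b i + y)"
proof (cases "j = i")
  case True
  consider "p = l i" | "p = r i" | "q = b i" | "q = t i" using assms True by auto
  then show ?thesis
  proof cases
    case 1
    then show ?thesis
      using assms True dims_pos by (intro exI[of _ 0] conjI zero) (auto simp: on_T_def h_def)
  next
    case 2
    then show ?thesis
      using assms True dims_pos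
      by (intro exI[of _ "- w'"] exI[of _ h'] conjI glue_right) (auto simp: on_T_def h_def w'_def)
  next
    case 3
    then show ?thesis
      using assms True dims_pos by (intro exI[of _ 0] conjI zero) (auto simp: on_T_def w'_def)
  next
    case 4
    then show ?thesis
      using assms True dims_pos neg[OF glue_left]
      by (intro exI[of _ "- w"] exI[of _ "- h"]) (auto simp: on_T_def h_def w'_def)
  qed
next
  case False
  then have j: "j = (\<not> i)" by auto
  consider "p = l j" | "p = r j" | "q = b j" | "q = t j" using assms by auto
  then show ?thesis
  proof cases
    case 1
    then show ?thesis
      using assms j dims_pos
      by (intro exI[of _ "l i - r (\<not> i) + w"] exI[of _ "b i - b (\<not> i) + h"] conjI add[OF base glue_left])
        (auto simp: on_T_def h'_def w_def)
  next
    case 2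
    then show ?thesis
      using assms j dims_pos
      by (intro exI[of _ "l i - r (\<not> i)"] exI[of _ "b i - b (\<not> i)"] conjI base)
        (auto simp: on_T_def h'_def)
  next
    case 3
    then show ?thesis
      using assms j dims_pos
      by (intro exI[of _ "l i - r (\<not> i)"] exI[of _ "b i - b (\<not> i)"] conjI base)
        (auto simp: on_T_def w_def)
  next
    case 4
    then show ?thesis
      using assms j dims_pos
      by (intro exI[of _ "l i - r (\<not> i) - - w'"] exI[of _ "b i - b (\<not> i) - h'"]
          conjI diff[OF base glue_right])
        (auto simp: on_T_def h'_def w_def)
  qed
qed

lemma free_iff_on_T:
  "free p q \<longleftrightarrow> (\<exists>x y. (x, y) \<in> \<Lambda> \<and> on_T (p - l i + x) (q - b i + y))"
proof
  assume "free p q"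
  then obtain j x y where "(x, y) \<in> \<Lambda>" "l j + x \<le> p" "p \<le> r j + x" "b j + y \<le> q" "q \<le> t j + y"
    "p = l j + x \<or> p = r j + x \<or> q = b j + y \<or> q = t j + y"
    by (rule free_imp_boundary)
  moreover from this have "\<exists>x' y'. (x', y') \<in> \<Lambda> \<and> on_T (p - x - l i + x') (q - y - b i + y')"
    by (intro tile_boundary_on_T[of j]) auto
  then obtain x' y' where "(x', y') \<in> \<Lambda>" "on_T (p - x - l i + x') (q - y - b i + y')" by blast
  ultimately show "\<exists>x y. (x, y) \<in> \<Lambda> \<and> on_T (p - l i + x) (q - b i + y)"
    by (intro exI[of _ "x' - x"] exI[of _ "y' - y"]) (auto simp: algebra_simps diff)
next
  assume "\<exists>x y. (x, y) \<in> \<Lambda> \<and> on_T (p - l i + x) (q - b i + y)"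
  then obtain x y where "(x, y) \<in> \<Lambda>" "on_T (p - l i + x) (q - b i + y)" by blast
  from free_translate[OF on_T_imp_free[OF this(2)] neg[OF this(1)]]
  show "free p q" by (simp add: algebra_simps)
qed

end

section \<open>Irrational slopes and arcs on the torus\<close>

lemma irrational_multiple_Ints:
  fixes m x :: real
  assumes "m \<notin> \<rat>" "x \<in> \<int>" "m * x \<in> \<int>"
  shows "x = 0"
proof (rule ccontr)
  assume "x \<noteq> 0"
  then have "m = m * x / x" by simp
  moreover have "m * x / x \<in> \<rat>"
    using assms(2,3) Ints_subset_Rats by (intro Rats_divide) auto
  ultimately show False using assms(1) by simp
qed

lemma torus_proj_eq_iff:
  "torus_proj a = torus_proj a' \<longleftrightarrow> fst a - fst a' \<in> \<int> \<and> snd a - snd a' \<in> \<int>"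
  by (simp add: torus.abs_eq_iff lattice_rel_def)

text \<open>A horizontal meets each of the countably many integer translates of the segment at most
  once, as the slope is nonzero. Hence finitely many arcs cannot fill an interval of a
  horizontal.\<close>

lemma countable_arc_on_horizontal:
  assumes "irrational_line E" "torus_arc E \<alpha>"
  shows "countable {s. torus_proj (p + (s, 0)) \<in> \<alpha>}"
proof -
  obtain m where m: "m \<notin> \<rat>" and E: "E = {(x, m * x) | x. True}"
    using assms(1) unfolding irrational_line_def by blast
  obtain a c where ac: "c - a \<in> E" and \<alpha>: "\<alpha> = torus_proj ` closed_segment a c"
    using assms(2) unfolding torus_arc_def by blast
  obtain x where x: "c - a = (x, m * x)" using ac E by blast
  from m have "m \<noteq> 0" by auto
  \<comment> \<open>The only shift \<open>s\<close> for which \<open>p + (s, 0)\<close> lies on the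
    line of the segment translated by \<open>(k, k')\<close>.\<close>
  let ?f = "\<lambda>(k, k'). fst a + (snd p - k' - snd a) / m - fst p + k"
  have "{s. torus_proj (p + (s, 0)) \<in> \<alpha>} \<subseteq> ?f ` (\<int> \<times> \<int>)"
  proof clarify
    fix s assume "torus_proj (p + (s, 0)) \<in> \<alpha>"
    then obtain z where z: "z \<in> closed_segment a c" "torus_proj (p + (s, 0)) = torus_proj z"
      using \<alpha> by auto
    then obtain u where "z = a + u *\<^sub>R (c - a)"
      by (auto simp: closed_segment_def algebra_simps)
    then have u: "z = (fst a + u * x, snd a + u * (m * x))"
      using x by (simp add: prod_eq_iff)
    let ?k = "fst p + s - fst z" and ?k' = "snd p - snd z"
    have "?k \<in> \<int>" "?k' \<in> \<int>" using z(2) by (auto simp: torus_proj_eq_iff)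
    moreover have "s = ?f (?k, ?k')"
      using \<open>m \<noteq> 0\<close> by (simp add: u field_simps)
    ultimately show "s \<in> ?f ` (\<int> \<times> \<int>)" by blast
  qed
  moreover have "countable (\<int> :: real set)" by (simp add: Ints_def)
  ultimately show ?thesis by (meson countable_SIGMA countable_image countable_subset)
qed

section \<open>Coordinates along the two directions\<close>

locale two_slopes =
  fixes m1 m2 :: real
  assumes irrational: "m1 \<notin> \<rat>" "m2 \<notin> \<rat>" and slopes_differ: "m1 \<noteq> m2"
begin

text \<open>In the coordinates given by \<open>skew\<close>, the two directions are the coordinate axes.\<close>

definition skew :: "real \<times> real \<Rightarrow> real \<times> real" where
  "skew z = (fst z + snd z, m1 * fst z + m2 * snd z)"

text \<open>The period lattice of \<open>torus_proj\<close> composed with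
  \<open>skew\<close>.\<close>

definition \<Lambda> :: "(real \<times> real) set" where
  "\<Lambda> = {g. fst (skew g) \<in> \<int> \<and> snd (skew g) \<in> \<int>}"

lemma linear_skew: "linear skew"
  by (rule linearI) (auto simp: skew_def algebra_simps)

lemma inj_skew: "inj skew"
proof (rule injI)
  fix z z' assume "skew z = skew z'"
  then have 1: "fst z - fst z' = snd z' - snd z"
    and 2: "m1 * (fst z - fst z') = m2 * (snd z' - snd z)"
    by (auto simp: skew_def algebra_simps)
  from 2 have "(m1 - m2) * (fst z - fst z') = 0"
    unfolding 1 by (simp add: algebra_simps)
  then show "z = z'" using 1 slopes_differ by (simp add: prod_eq_iff)
qed

lemma surj_skew: "surj skew"
  using linear_inj_imp_surj[OF linear_skew inj_skew] .

lemma proj_skew_eq_iff: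
  "torus_proj (skew (x, y)) = torus_proj (skew (x', y')) \<longleftrightarrow> (x - x', y - y') \<in> \<Lambda>"
  by (simp add: torus_proj_eq_iff \<Lambda>_def skew_def algebra_simps)

lemma proj_skew_eq_iff':
  "torus_proj (skew z) = torus_proj (skew z') \<longleftrightarrow> z - z' \<in> \<Lambda>"
  by (metis proj_skew_eq_iff prod.collapse minus_prod_def)

section \<open>From a partition to a tiling by closed boxes\<close>

lemma finite_\<Lambda>_bounded: "finite {g \<in> \<Lambda>. norm g \<le> K}"
proof (rule finite_imageD)
  obtain B where B: "B > 0" "\<And>x. norm (skew x) \<le> B * norm x"
    using linear_bounded_pos[OF linear_skew] by blast
  let ?S = "{k :: real. k \<in> \<int> \<and> \<bar>k\<bar> \<le> B * K}"
  have "skew g \<in> ?S \<times> ?S" if "g \<in> \<Lambda>" "norm g \<le> K" for g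
  proof -
    have "norm (skew g) \<le> B * K"
      using B that(2) by (meson mult_left_mono order_trans less_imp_le)
    then have "\<bar>fst (skew g)\<bar> \<le> B * K" "\<bar>snd (skew g)\<bar> \<le> B * K"
      using norm_fst_le[of "fst (skew g)" "snd (skew g)"] norm_snd_le[of "snd (skew g)" "fst (skew g)"]
      by auto
    then show ?thesis using that(1) by (simp add: \<Lambda>_def mem_Times_iff)
  qed
  then have "skew ` {g \<in> \<Lambda>. norm g \<le> K} \<subseteq> ?S \<times> ?S" by blast
  then show "finite (skew ` {g \<in> \<Lambda>. norm g \<le> K})"
    by (rule finite_subset) (intro finite_cartesian_product finite_abs_int_segment)
qed (use inj_skew in \<open>blast intro: inj_on_subset\<close>)

text \<open>By boundedness only finitely many translates are involved, so one contains infinitely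
  many terms and, being closed, also the limit. Retaining a term in the same translate is what later
  yields \<open>quadrant\<close>.\<close>

lemma tile_of_limit:
  fixes C :: "bool \<Rightarrow> (real \<times> real) set"
  assumes C: "\<And>j. compact (C j)" and Z: "Z \<longlonglongrightarrow> z"
    and tile: "\<And>n. \<exists>j. \<exists>g\<in>\<Lambda>. Z n - g \<in> C j"
  shows "\<exists>j. \<exists>g\<in>\<Lambda>. z - g \<in> C j \<and> (\<exists>n. Z n - g \<in> C j)"
proof -
  obtain K where K: "\<And>n. norm (Z n) \<le> K"
    using Z convergent_imp_Bseq[of Z] unfolding convergent_def Bseq_def by blast
  have "bounded (C True \<union> C False)"
    using C compact_imp_bounded by blast
  then obtain K' where K': "\<And>y. y \<in> C True \<union> C False \<Longrightarrow> norm y \<le> K'"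
    unfolding bounded_iff by blast
  then have K'': "norm y \<le> K'" if "y \<in> C j" for j y
    using that by (cases j) auto
  let ?G = "{g \<in> \<Lambda>. norm g \<le> K + K'}"
  have near: "\<exists>jg \<in> UNIV \<times> ?G. Z n - snd jg \<in> C (fst jg)" for n
  proof -
    obtain j g where jg: "g \<in> \<Lambda>" "Z n - g \<in> C j" using tile by blast
    have "norm g \<le> norm (Z n) + norm (Z n - g)"
      using norm_triangle_ineq4[of "Z n" "Z n - g"] by simp
    then have "norm g \<le> K + K'" using K[of n] K''[OF jg(2)] by linarith
    with jg show ?thesis by (intro bexI[of _ "(j, g)"]) auto
  qed
  have fin: "finite (UNIV \<times> ?G :: (bool \<times> (real \<times> real)) set)"
    by (intro finite_cartesian_product finite_\<Lambda>_bounded finite)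
  have "\<exists>jg \<in> UNIV \<times> ?G. infinite {n \<in> UNIV :: nat set. Z n - snd jg \<in> C (fst jg)}"
    by (rule pigeonhole_infinite_rel[OF infinite_UNIV_nat fin]) (intro ballI near)
  then obtain jg where jg: "jg \<in> UNIV \<times> ?G"
    and "infinite {n \<in> UNIV :: nat set. Z n - snd jg \<in> C (fst jg)}" by (rule bexE)
  then have inf: "infinite {n. Z n - snd jg \<in> C (fst jg)}" by simp
  obtain j g where [simp]: "jg = (j, g)" by (cases jg)
  have "z - g \<in> C j"
  proof (rule ccontr)
    assume "z - g \<notin> C j"
    moreover have "(\<lambda>n. Z n - g) \<longlonglongrightarrow> z - g" by (intro tendsto_intros Z)
    moreover have "open (- C j)" using C compact_imp_closed by blast
    ultimately have "\<forall>\<^sub>F n in sequentially. Z n - g \<in> - C j"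
      by (intro topological_tendstoD) auto
    then obtain N where "\<And>n. n \<ge> N \<Longrightarrow> Z n - g \<notin> C j"
      by (auto simp: eventually_sequentially)
    then have "{n. Z n - g \<in> C j} \<subseteq> {..<N}" by (auto simp flip: not_le)
    then show False using inf finite_subset[OF _ finite_lessThan] by simp
  qed
  moreover obtain n where "Z n - g \<in> C j"
    using not_finite_existsD[OF inf] by (elim exE) simp
  ultimately show ?thesis using jg by auto
qed

text \<open>The shifts follow \<open>e\<close>, which \<open>skew\<close> sends to the horizontal of
  the original plane; arbitrarily small ones lie outside a countable set.\<close>

lemma avoiding_sequence:
  assumes "\<And>p. countable {s. torus_proj (p + (s, 0)) \<in> X}"
  shows "\<exists>Z. Z \<longlonglongrightarrow> z \<and> (\<forall>n. torus_proj (skew (Z n)) \<notin> X)"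
proof -
  obtain e where e: "skew e = (1, 0)" using surj_skew by (metis surjD)
  have "\<exists>s \<in> {0<..<1 / real (Suc n)}. s \<notin> {s. torus_proj (skew z + (s, 0)) \<in> X}" for n
    by (rule real_interval_avoid_countable_set) (use assms in auto)
  then obtain s where s: "\<And>n. 0 < s n" "\<And>n. s n < 1 / real (Suc n)"
    "\<And>n. torus_proj (skew z + (s n, 0)) \<notin> X"
    by (simp add: Bex_def) metis
  have "s \<longlonglongrightarrow> 0"
    by (rule tendsto_sandwich[OF _ _ tendsto_const LIMSEQ_Suc[OF lim_1_over_n]])
      (intro always_eventually allI less_imp_le s)+
  then have "(\<lambda>n. z + s n *\<^sub>R e) \<longlonglongrightarrow> z + 0 *\<^sub>R e" by (intro tendsto_intros)
  moreover have "skew (z + s n *\<^sub>R e) = skew z + (s n, 0)" for n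
    using e by (simp add: linear_add[OF linear_skew] linear_scale[OF linear_skew])
  ultimately show ?thesis using s(3) by (intro exI[of _ "\<lambda>n. z + s n *\<^sub>R e"]) auto
qed

lemma interior_skew_box:
  "interior (skew ` ({l..r} \<times> {b..t})) = skew ` ({l<..<r} \<times> {b<..<t})"
  by (simp add: interior_injective_linear_image[OF linear_skew inj_skew] interior_Times)

lemma box_tiling_of_partition:
  fixes l r b t :: "bool \<Rightarrow> real"
  defines "T \<equiv> \<lambda>i. torus_proj ` skew ` ({l i<..<r i} \<times> {b i<..<t i})"
  assumes pos: "\<And>i. l i < r i" "\<And>i. b i < t i"
    and inj: "\<And>i. inj_on torus_proj (skew ` ({l i<..<r i} \<times> {b i<..<t i}))"
    and disj: "T True \<inter> T False = {}"
    and thin: "\<And>p. countable {s. torus_proj (p + (s, 0)) \<in> UNIV - (T True \<union> T False)}"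
  shows "box_tiling \<Lambda> l r b t"
proof
  let ?C = "\<lambda>i. {l i..r i} \<times> {b i..t i}"
  have C: "compact (?C i)" for i
    by (intro compact_Times compact_Icc)
  \<comment> \<open>By \<open>thin\<close>, points of open tiles approach every \<open>z\<close>, so
    closed tiles cover the plane.\<close>
  have cover: "\<exists>j. \<exists>g\<in>\<Lambda>. z - g \<in> ?C j" for z
  proof -
    obtain Z where Z: "Z \<longlonglongrightarrow> z" "\<And>n. torus_proj (skew (Z n)) \<notin> UNIV - (T True \<union> T False)"
      using avoiding_sequence[OF thin] by blast
    have "\<exists>j. \<exists>g\<in>\<Lambda>. Z n - g \<in> ?C j" for n
    proof -
      obtain j where "torus_proj (skew (Z n)) \<in> T j" using Z(2)[of n] by blast
      then obtain y where "y \<in> {l j<..<r j} \<times> {b j<..<t j}" "Z n - y \<in> \<Lambda>"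
        unfolding T_def using proj_skew_eq_iff' by blast
      then show ?thesis by (intro exI[of _ j] bexI[of _ "Z n - y"]) auto
    qed
    from tile_of_limit[where C = ?C, OF C Z(1) this] show ?thesis by metis
  qed
  fix \<sigma> \<tau> p q :: real
  assume "\<sigma> \<in> {-1, 1}" "\<tau> \<in> {-1, 1}"
  \<comment> \<open>A sequence on the diagonal of the quadrant. A box containing its limit and one
    of its terms contains the square spanned by them, whence \<open>d\<close> is
    \<open>1 / real (Suc n)\<close>.\<close>
  let ?Z = "\<lambda>n. (p + \<sigma> * (1 / real (Suc n)), q + \<tau> * (1 / real (Suc n)))"
  have "?Z \<longlonglongrightarrow> (p + \<sigma> * 0, q + \<tau> * 0)"
    by (intro tendsto_intros LIMSEQ_Suc[OF lim_1_over_n])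
  from tile_of_limit[where C = ?C, OF C this cover] obtain j g n where
    "g \<in> \<Lambda>" "(p, q) - g \<in> ?C j" "?Z n - g \<in> ?C j" by auto
  then show "\<exists>j x y d. (x, y) \<in> \<Lambda> \<and> 0 < d \<and>
      l j + x \<le> p \<and> p \<le> r j + x \<and> l j + x \<le> p + \<sigma> * d \<and> p + \<sigma> * d \<le> r j + x \<and>
      b j + y \<le> q \<and> q \<le> t j + y \<and> b j + y \<le> q + \<tau> * d \<and> q + \<tau> * d \<le> t j + y"
    by (intro exI[of _ j] exI[of _ "fst g"] exI[of _ "snd g"] exI[of _ "1 / real (Suc n)"])
      (auto simp: mem_Times_iff simp del: of_nat_Suc)
next
  fix x y i j
  assume g: "(x, y) \<in> \<Lambda>" and *: "l i < r j + x" "l j + x < r i" "b i < t j + y" "b j + y < t i"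
  \<comment> \<open>A point interior to both boxes: disjointness forces \<open>i = j\<close>, and
    injectivity on one open box forces the translation to vanish.\<close>
  obtain p where p: "max (l i) (l j + x) < p" "p < min (r i) (r j + x)"
    using dense[of "max (l i) (l j + x)" "min (r i) (r j + x)"] * pos[of i] pos[of j] by auto
  obtain q where q: "max (b i) (b j + y) < q" "q < min (t i) (t j + y)"
    using dense[of "max (b i) (b j + y)" "min (t i) (t j + y)"] * pos[of i] pos[of j] by auto
  have i: "(p, q) \<in> {l i<..<r i} \<times> {b i<..<t i}"
    and j: "(p - x, q - y) \<in> {l j<..<r j} \<times> {b j<..<t j}"
    using p q by auto
  have eq: "torus_proj (skew (p, q)) = torus_proj (skew (p - x, q - y))"
    using g by (simp add: proj_skew_eq_iff)
  have "torus_proj (skew (p, q)) \<in> T i" "torus_proj (skew (p, q)) \<in> T j"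
    using i j eq unfolding T_def by blast+
  then have [simp]: "i = j" using disj by (cases i; cases j) auto
  have "skew (p, q) = skew (p - x, q - y)"
    by (rule inj_onD[OF inj[of j] eq]) (use i j in auto)
  then have "(p, q) = (p - x, q - y)" using inj_skew by (blast dest: injD)
  then show "i = j \<and> x = 0 \<and> y = 0" by simp
next
  \<comment> \<open>\<open>skew (x, 0)\<close> is an integer point on the line of slope
    \<open>m1\<close>, hence the origin.\<close>
  fix x assume "(x, 0) \<in> \<Lambda>"
  then show "x = 0"
    using irrational_multiple_Ints[OF irrational(1)] by (simp add: \<Lambda>_def skew_def)
next
  fix y assume "(0, y) \<in> \<Lambda>"
  then show "y = 0"
    using irrational_multiple_Ints[OF irrational(2)] by (simp add: \<Lambda>_def skew_def)
next
  fix x y x' y' assume "(x, y) \<in> \<Lambda>" "(x', y') \<in> \<Lambda>"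
  then show "(x + x', y + y') \<in> \<Lambda>"
    using linear_add[OF linear_skew, of "(x, y)" "(x', y')"] by (simp add: \<Lambda>_def)
next
  fix x y assume "(x, y) \<in> \<Lambda>"
  then show "(- x, - y) \<in> \<Lambda>"
    using linear_neg[OF linear_skew, of "(x, y)"] by (simp add: \<Lambda>_def)
qed (use pos in auto)

lemma markov_parallelogram_skew_box:
  assumes "markov_parallelogram {(x, m1 * x) | x. True} {(x, m2 * x) | x. True} R"
  obtains l r b t where "l < r" "b < t" "R = skew ` ({l..r} \<times> {b..t})"
proof -
  obtain a u v where u: "u \<in> {(x, m1 * x) | x. True}" "u \<noteq> 0"
    and v: "v \<in> {(x, m2 * x) | x. True}" "v \<noteq> 0"
    and R: "R = {a + s *\<^sub>R u + t *\<^sub>R v | s t. s \<in> {0..1} \<and> t \<in> {0..1}}"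
    using assms unfolding markov_parallelogram_def by blast
  obtain x y where uv: "u = (x, m1 * x)" "v = (y, m2 * y)" using u v by blast
  then have xy: "x \<noteq> 0" "y \<noteq> 0" using u v by (auto simp: zero_prod_def)
  obtain z where "a = skew z" using surj_skew by (rule surjE)
  then obtain c d where a: "a = skew (c, d)" by (cases z) blast
  have *: "a + s *\<^sub>R u + t *\<^sub>R v = skew (c + s * x, d + t * y)" for s t
    by (simp add: a uv skew_def algebra_simps)
  have "R = skew ` ((\<lambda>s. c + s * x) ` {0..1} \<times> (\<lambda>t. d + t * y) ` {0..1})"
    unfolding R * by blast
  \<comment> \<open>The spanning vectors may point either way, hence \<open>min\<close> and
    \<open>max\<close>.\<close>
  moreover have "(\<lambda>s. c + s * x) ` {0..1} = {min c (c + x)..max c (c + x)}" for c x :: real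
  proof -
    have "(\<lambda>s. c + s * x) ` {0..1} = closed_segment c (c + x)"
      by (simp add: closed_segment_image_interval algebra_simps)
    then show ?thesis by (auto simp: closed_segment_eq_real_ivl)
  qed
  ultimately have R': "R = skew ` ({min c (c + x)..max c (c + x)} \<times> {min d (d + y)..max d (d + y)})"
    by (simp only:)
  show thesis
  proof (rule that[OF _ _ R'])
    show "min c (c + x) < max c (c + x)" using xy by (simp add: min_def max_def)
    show "min d (d + y) < max d (d + y)" using xy by (simp add: min_def max_def)
  qed
qed

section \<open>From the matched tiling to the T-configuration\<close>

lemma closed_segment_skew_horizontal:
  assumes "p \<le> p'"
  shows "closed_segment (skew (p, q)) (skew (p', q)) = skew ` ({p..p'} \<times> {q})"
proof -
  have "(1 - u) *\<^sub>R (p, q) + u *\<^sub>R (p', q) = ((1 - u) * p + u * p', q)" for u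
    by (simp add: algebra_simps)
  then have "closed_segment (p, q) (p', q) = (\<lambda>x. (x, q)) ` closed_segment p p'"
    by (simp add: closed_segment_image_interval image_image)
  then have "closed_segment (p, q) (p', q) = {p..p'} \<times> {q}"
    by (auto simp: closed_segment_eq_real_ivl1[OF assms])
  then show ?thesis by (simp add: closed_segment_linear_image[OF linear_skew])
qed

lemma T_configuration_of_tiling:
  assumes "matched_box_tiling \<Lambda> l r b t i"
    and N: "\<And>p q. torus_proj (skew (p, q)) \<in> N \<longleftrightarrow> box_tiling.free \<Lambda> l r b t p q"
  shows "\<exists>Q v I tA tB tC.
    T_configuration_on {(x, m1 * x) | x. True} {(x, m2 * x) | x. True} Q v I tA tB \<and>
    next_hit Q v I tB tC \<and> N = arc_PC Q v tC \<union> I"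
proof -
  interpret box_tiling \<Lambda> l r b t
    using assms(1) by (rule matched_box_tiling.axioms)
  define w w' h h' where dims: "w = r (\<not> i) - l (\<not> i)" "w' = r i - l i" "h = t i - b i"
    "h' = t (\<not> i) - b (\<not> i)"
  interpret M: matched_box_tiling \<Lambda> l r b t i w w' h h'
    by fact (rule dims[THEN eq_reflection])+
  note pos = M.dims_pos
  \<comment> \<open>Normalizing the direction of the ray turns a height \<open>s\<close> into the
    distance \<open>c * s\<close> from \<open>Q\<close>.\<close>
  define c where "c = norm (skew (0, 1))"
  have c: "c > 0"
    by (simp add: c_def skew_def zero_prod_def)
  define Q where "Q = skew (l i, b i)"
  define v where "v = (1 / c) *\<^sub>R skew (0, 1)"
  define \<alpha> where "\<alpha> = skew (l i - w, b i)"
  define \<beta> where "\<beta> = skew (l i + w', b i)"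
  define I where "I = torus_proj ` closed_segment \<alpha> \<beta>"
  have ray: "ray_point Q v s = skew (l i, b i + s / c)" for s
    by (simp add: ray_point_def Q_def v_def skew_def algebra_simps)
  have I_iff: "torus_proj (skew (p, q)) \<in> I \<longleftrightarrow> (\<exists>x\<in>{- w..w'}. (p - (l i + x), q - b i) \<in> \<Lambda>)" for p q
  proof -
    have "torus_proj (skew (p, q)) \<in> I \<longleftrightarrow>
      (\<exists>p'\<in>{l i - w..l i + w'}. torus_proj (skew (p, q)) = torus_proj (skew (p', b i)))"
      unfolding I_def \<alpha>_def \<beta>_def
      using pos by (subst closed_segment_skew_horizontal) auto
    also have "\<dots> \<longleftrightarrow> (\<exists>x\<in>{- w..w'}. torus_proj (skew (p, q)) = torus_proj (skew (l i + x, b i)))"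
    proof
      assume "\<exists>p'\<in>{l i - w..l i + w'}. torus_proj (skew (p, q)) = torus_proj (skew (p', b i))"
      then obtain p' where "p' \<in> {l i - w..l i + w'}"
        "torus_proj (skew (p, q)) = torus_proj (skew (p', b i))" by blast
      then show "\<exists>x\<in>{- w..w'}. torus_proj (skew (p, q)) = torus_proj (skew (l i + x, b i))"
        by (intro bexI[of _ "p' - l i"]) auto
    next
      assume "\<exists>x\<in>{- w..w'}. torus_proj (skew (p, q)) = torus_proj (skew (l i + x, b i))"
      then obtain x where "x \<in> {- w..w'}"
        "torus_proj (skew (p, q)) = torus_proj (skew (l i + x, b i))" by blast
      then show "\<exists>p'\<in>{l i - w..l i + w'}. torus_proj (skew (p, q)) = torus_proj (skew (p', b i))"
        by (intro bexI[of _ "l i + x"]) auto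
    qed
    finally show ?thesis by (simp only: proj_skew_eq_iff)
  qed
  have Q_mem: "Q \<in> open_segment \<alpha> \<beta>"
  proof -
    have "(l i, b i) \<in> {l i - w..l i + w'} \<times> {b i}" using pos by simp
    moreover have "l i - w \<le> l i + w'" using pos by simp
    ultimately have "Q \<in> closed_segment \<alpha> \<beta>"
      unfolding Q_def \<alpha>_def \<beta>_def by (simp only: closed_segment_skew_horizontal imageI)
    moreover have "Q \<noteq> \<alpha>" "Q \<noteq> \<beta>"
      using pos inj_skew by (auto simp: Q_def \<alpha>_def \<beta>_def inj_eq)
    ultimately show ?thesis by (simp add: open_segment_def)
  qed
  have ends: "\<alpha> - Q \<in> {(x, m1 * x) | x. True}" "\<beta> - Q \<in> {(x, m1 * x) | x. True}"
    by (auto simp: \<alpha>_def \<beta>_def Q_def skew_def algebra_simps)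
  \<comment> \<open>\<open>glue_left\<close> carries the left end of the base to height
    \<open>h\<close> on the stem; likewise \<open>glue_right\<close> carries the right end to height
    \<open>h'\<close>.\<close>
  have hit_left: "torus_proj \<alpha> = torus_proj (ray_point Q v (c * h))"
    using neg[OF M.glue_left] c by (simp add: \<alpha>_def ray proj_skew_eq_iff)
  have hit_right: "torus_proj \<beta> = torus_proj (ray_point Q v (c * h'))"
    using neg[OF M.glue_right] c by (simp add: \<beta>_def ray proj_skew_eq_iff)
  have miss: "torus_proj (ray_point Q v s) \<notin> I"
    if s: "0 < s" "s < c * (h + h')" "s \<noteq> c * h" "s \<noteq> c * h'" for s
  proof -
    have "0 < s / c" "s / c < h + h'" "s / c \<noteq> h" "s / c \<noteq> h'"
      using s c by (auto simp: field_simps)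
    from M.vertical_avoids_base[folded dims, OF this] show ?thesis
      by (auto simp: ray I_iff)
  qed
  \<comment> \<open>The smaller height is reached first, so it decides which end of the base is
    \<open>A\<close>.\<close>
  define tA where "tA = c * min h h'"
  define tB where "tB = c * max h h'"
  define tC where "tC = c * (h + h')"
  have times: "0 < tA" "tA < tB" "tB < tC"
    using c pos M.heights_differ by (auto simp: tA_def tB_def tC_def min_def max_def)
  have "T_configuration_on {(x, m1 * x) | x. True} {(x, m2 * x) | x. True} Q v I tA tB"
    unfolding T_configuration_on_def
  proof (intro conjI allI impI times)
    show "v \<in> {(x, m2 * x) | x. True}"
      by (auto simp: v_def skew_def)
    show "norm v = 1"
      using c by (simp add: v_def c_def)
    show "\<exists>a a'. a - Q \<in> {(x, m1 * x) | x. True} \<and> a' - Q \<in> {(x, m1 * x) | x. True} \<and>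
        Q \<in> open_segment a a' \<and> I = torus_proj ` closed_segment a a' \<and>
        torus_proj a = torus_proj (ray_point Q v tA) \<and>
        torus_proj a' = torus_proj (ray_point Q v tB)"
    proof (cases "h < h'")
      case True
      then have "tA = c * h" "tB = c * h'" by (auto simp: tA_def tB_def)
      then show ?thesis
        using ends Q_mem hit_left hit_right I_def by blast
    next
      case False
      then have "tA = c * h'" "tB = c * h" by (auto simp: tA_def tB_def)
      moreover have "Q \<in> open_segment \<beta> \<alpha>" "I = torus_proj ` closed_segment \<beta> \<alpha>"
        using Q_mem I_def by (simp_all add: open_segment_commute closed_segment_commute)
      ultimately show ?thesis
        using ends hit_left hit_right by blast
    qed
    fix s assume s: "0 < s \<and> s < tB \<and> s \<noteq> tA"
    then have "s \<noteq> c * h" "s \<noteq> c * h'"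
      by (auto simp: tA_def tB_def min_def max_def split: if_splits)
    then show "torus_proj (ray_point Q v s) \<notin> I"
      using miss[of s] s times by (simp add: tC_def)
  qed
  moreover have "next_hit Q v I tB tC"
    unfolding next_hit_def
  proof (intro conjI allI impI times)
    \<comment> \<open>The sum of the two gluing vectors carries the base point at offset
      \<open>w' - w\<close> to the top of the stem.\<close>
    have "(w - w', h + h') \<in> \<Lambda>"
      using add[OF M.glue_left M.glue_right] by simp
    then show "torus_proj (ray_point Q v tC) \<in> I"
      unfolding ray I_iff using c pos by (intro bexI[of _ "w' - w"]) (auto simp: tC_def)
    fix s assume s: "tB < s \<and> s < tC"
    then have "s \<noteq> c * h" "s \<noteq> c * h'"
      using c times by (auto simp: tB_def max_def split: if_splits)
    then show "torus_proj (ray_point Q v s) \<notin> I"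
      using miss[of s] s times by (simp add: tC_def)
  qed
  moreover have "N = arc_PC Q v tC \<union> I"
  proof -
    have arc: "torus_proj (skew (p, q)) \<in> arc_PC Q v tC \<longleftrightarrow>
      (\<exists>s\<in>{0..h + h'}. (p - l i, q - (b i + s)) \<in> \<Lambda>)" for p q
    proof -
      have "arc_PC Q v tC = (\<lambda>s. torus_proj (skew (l i, b i + s))) ` (\<lambda>s. s / c) ` {0..tC}"
        by (simp add: arc_PC_def ray image_image)
      also have "(\<lambda>s. s / c) ` {0..tC} = {0..h + h'}"
        using c pos by (simp add: tC_def)
      finally show ?thesis
        by (auto simp: proj_skew_eq_iff)
    qed
    \<comment> \<open>Rewrites a translation into the T as congruence to a point of the T, the form
      of \<open>arc\<close> and \<open>I_iff\<close>.\<close>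
    have shift: "(\<exists>x y. (x, y) \<in> \<Lambda> \<and> S (p + x) (q + y)) \<longleftrightarrow>
      (\<exists>p' q'. (p - p', q - q') \<in> \<Lambda> \<and> S p' q')" for S p q
    proof
      assume "\<exists>x y. (x, y) \<in> \<Lambda> \<and> S (p + x) (q + y)"
      then obtain x y where xy: "(x, y) \<in> \<Lambda>" "S (p + x) (q + y)" by blast
      from neg[OF xy(1)] xy(2) show "\<exists>p' q'. (p - p', q - q') \<in> \<Lambda> \<and> S p' q'"
        by (intro exI[of _ "p + x"] exI[of _ "q + y"]) simp
    next
      assume "\<exists>p' q'. (p - p', q - q') \<in> \<Lambda> \<and> S p' q'"
      then obtain p' q' where pq: "(p - p', q - q') \<in> \<Lambda>" "S p' q'" by blast
      from neg[OF pq(1)] pq(2) show "\<exists>x y. (x, y) \<in> \<Lambda> \<and> S (p + x) (q + y)"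
        by (intro exI[of _ "p' - p"] exI[of _ "q' - q"]) simp
    qed
    have "torus_proj (skew (p, q)) \<in> N \<longleftrightarrow> torus_proj (skew (p, q)) \<in> arc_PC Q v tC \<union> I" for p q
    proof -
      have "torus_proj (skew (p, q)) \<in> N \<longleftrightarrow>
          (\<exists>p' q'. (p - l i - p', q - b i - q') \<in> \<Lambda> \<and> M.on_T p' q')"
        by (simp only: N M.free_iff_on_T shift)
      also have "\<dots> \<longleftrightarrow>
          (\<exists>x\<in>{- w..w'}. (p - l i - x, q - b i) \<in> \<Lambda>) \<or> (\<exists>s\<in>{0..h + h'}. (p - l i, q - b i - s) \<in> \<Lambda>)"
        unfolding M.on_T_def by (simp add: conj_disj_distribL ex_disj_distrib Bex_def conj_commute)
      also have "\<dots> \<longleftrightarrow> torus_proj (skew (p, q)) \<in> arc_PC Q v tC \<union> I"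
        unfolding Un_iff arc I_iff by (simp add: diff_diff_add disj_commute)
      finally show ?thesis .
    qed
    moreover have "\<exists>p q. z = torus_proj (skew (p, q))" for z
    proof -
      obtain y where "torus_rep z = skew y" using surj_skew by (rule surjE)
      then have "z = torus_proj (skew (fst y, snd y))"
        by (metis Quotient3_abs_rep[OF Quotient3_torus] prod.collapse)
      then show ?thesis by blast
    qed
    ultimately show ?thesis by (intro set_eqI) metis
  qed
  ultimately show ?thesis by blast
qed

end

theorem mainTheorem3:
  fixes E1 E2 :: "(real \<times> real) set" and M :: "(real \<times> real) set set"
  assumes "irrational_line E1" and "irrational_line E2" and "E1 \<noteq> E2"
    and "quasi_markov_partition E1 E2 M" and "card M = 2"
  shows "\<exists>Q w I tA tB tC.
           T_configuration E1 E2 Q w I tA tB \<and> next_hit Q w I tB tC \<and>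
           interiors_complement M = arc_PC Q w tC \<union> I"
proof -
  obtain m1 where m1: "m1 \<notin> \<rat>" and E1: "E1 = {(x, m1 * x) | x. True}"
    using assms(1) unfolding irrational_line_def by blast
  obtain m2 where m2: "m2 \<notin> \<rat>" and E2: "E2 = {(x, m2 * x) | x. True}"
    using assms(2) unfolding irrational_line_def by blast
  interpret two_slopes m1 m2
    using m1 m2 assms(3) E1 E2 by unfold_locales auto
  obtain R1 R2 where M: "M = {R1, R2}" "R1 \<noteq> R2"
    using assms(5) by (auto simp: card_2_iff)
  define R where "R i = (if i then R1 else R2)" for i
  have R_mem: "R i \<in> M" for i by (simp add: R_def M)
  have R_markov: "markov_parallelogram E1 E2 (R i)"
    and R_inj: "inj_on torus_proj (interior (R i))" for i
    using assms(4) R_mem[of i]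
    unfolding quasi_markov_partition_def torus_markov_parallelogram_def by auto
  have "\<exists>l r b t. l < r \<and> b < t \<and> R i = skew ` ({l..r} \<times> {b..t})" for i
    using markov_parallelogram_skew_box[OF R_markov[of i, unfolded E1 E2]] by metis
  then obtain l r b t where pos: "\<And>i. l i < r i" "\<And>i. b i < t i"
    and R: "\<And>i. R i = skew ` ({l i..r i} \<times> {b i..t i})"
    by metis
  define T where "T i = torus_proj ` skew ` ({l i<..<r i} \<times> {b i<..<t i})" for i
  have T: "torus_proj ` interior (R i) = T i" for i
    by (simp add: R interior_skew_box T_def)
  have T': "torus_proj ` interior R1 = T True" "torus_proj ` interior R2 = T False"
    using T[of True] T[of False] by (simp_all add: R_def)
  have complement: "interiors_complement M = UNIV - (T True \<union> T False)"
    by (simp add: interiors_complement_def M T')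
  have disj: "T True \<inter> T False = {}"
    using assms(4) M unfolding quasi_markov_partition_def pairwise_def disjnt_def
    by (auto simp: T')
  obtain A where A: "finite A" "\<And>\<alpha>. \<alpha> \<in> A \<Longrightarrow> torus_arc E1 \<alpha> \<or> torus_arc E2 \<alpha>"
    "interiors_complement M = \<Union> A"
    using assms(4) unfolding quasi_markov_partition_def by metis
  have thin: "countable {s. torus_proj (p + (s, 0)) \<in> UNIV - (T True \<union> T False)}" for p
  proof -
    have "{s. torus_proj (p + (s, 0)) \<in> \<Union> A} = (\<Union>\<alpha>\<in>A. {s. torus_proj (p + (s, 0)) \<in> \<alpha>})"
      by blast
    moreover have "countable {s. torus_proj (p + (s, 0)) \<in> \<alpha>}" if "\<alpha> \<in> A" for \<alpha>
      using A(2)[OF that] countable_arc_on_horizontal[OF assms(1)] countable_arc_on_horizontal[OF assms(2)]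
      by (elim disjE)
    then have "countable (\<Union>\<alpha>\<in>A. {s. torus_proj (p + (s, 0)) \<in> \<alpha>})"
      by (rule countable_UN[OF countable_finite[OF A(1)]])
    ultimately show ?thesis by (simp only: A(3)[symmetric] complement[symmetric])
  qed
  have inj: "inj_on torus_proj (skew ` ({l i<..<r i} \<times> {b i<..<t i}))" for i
    using R_inj[of i] by (simp add: R interior_skew_box)
  interpret box_tiling \<Lambda> l r b t
    by (rule box_tiling_of_partition[OF pos inj disj[unfolded T_def] thin[unfolded T_def]])
  obtain i where "(l i - r (\<not> i), b i - b (\<not> i)) \<in> \<Lambda>"
    "(r (\<not> i) - l (\<not> i), t i - b i) \<in> \<Lambda>" "(- (r i - l i), t (\<not> i) - b (\<not> i)) \<in> \<Lambda>"
    by (rule corner_matching)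
  then have matched: "matched_box_tiling \<Lambda> l r b t i"
    by unfold_locales
  \<comment> \<open>Membership in an open parallelogram of the torus means that some lattice
    translate of its open box contains \<open>(p, q)\<close>.\<close>
  have free_iff: "torus_proj (skew (p, q)) \<in> interiors_complement M \<longleftrightarrow> free p q" for p q
  proof -
    have T_iff: "torus_proj (skew (p, q)) \<in> T j \<longleftrightarrow>
      (\<exists>x y. (x, y) \<in> \<Lambda> \<and> l j + x < p \<and> p < r j + x \<and> b j + y < q \<and> q < t j + y)" for j
    proof
      assume "torus_proj (skew (p, q)) \<in> T j"
      then obtain p' q' where "l j < p'" "p' < r j" "b j < q'" "q' < t j"
        "torus_proj (skew (p, q)) = torus_proj (skew (p', q'))"
        unfolding T_def by auto
      then show "\<exists>x y. (x, y) \<in> \<Lambda> \<and> l j + x < p \<and> p < r j + x \<and> b j + y < q \<and> q < t j + y"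
        by (intro exI[of _ "p - p'"] exI[of _ "q - q'"]) (auto simp: proj_skew_eq_iff)
    next
      assume "\<exists>x y. (x, y) \<in> \<Lambda> \<and> l j + x < p \<and> p < r j + x \<and> b j + y < q \<and> q < t j + y"
      then obtain x y where "(x, y) \<in> \<Lambda>" "l j + x < p" "p < r j + x" "b j + y < q" "q < t j + y"
        by blast
      then have "torus_proj (skew (p, q)) = torus_proj (skew (p - x, q - y))"
        "(p - x, q - y) \<in> {l j<..<r j} \<times> {b j<..<t j}"
        by (auto simp: proj_skew_eq_iff)
      then show "torus_proj (skew (p, q)) \<in> T j" unfolding T_def by blast
    qed
    show ?thesis
      unfolding complement free_def Diff_iff Un_iff T_iff all_bool_eq by blast
  qed
  from T_configuration_of_tiling[OF matched free_iff]
  show ?thesis unfolding T_configuration_def E1 E2 by blast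
qed

end
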